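(* For every real number $a>1/2$, the following three identities hold. (i) $$\frac{1}{(2a-1)\Gamma(2a)}=\frac{2a}{(2a-1)\Gamma(a+1)^2}\left(1-\Bigl(\frac{a}{a+1}\Bigr)^2\,{}_{3}F_2\Bigl(\begin{matrix}1,1,2a+1\\ a+2,a+2\end{matrix}\Bigl|1\Bigr)\right).$$ (ii) $$\frac{a+1}{a(2a-1)\Gamma(3a)}=\frac{3(a+1)}{(2a-1)\Gamma(a+1)^3}\left(1-\frac{3a^2}{(a+1)^3}\,{}_{4}F_3\Bigl(\begin{matrix}1,1,2,3a+1\\ a+2,a+2,a+2\end{matrix}\Bigl|1\Bigr)-\frac{a^3}{(a+1)^3}\,{}_{4}F_3\Bigl(\begin{matrix}1,1,1,3a+1\\ a+2,a+2,a+2\end{matrix}\Bigl|1\Bigr)\right).$$ (iii) $$\begin{aligned}\frac{6(2a^2+2a-1)}{(4a-1)(2a-1)^2\Gamma(4a)}=\frac{24a(2a^2+2a-1)}{(4a-1)(2a-1)^2\Gamma(a+1)^4}\biggl(1&-\frac{6a^2}{(a+1)^4}\,{}_{5}F_4\Bigl(\begin{matrix}1,1,2,2,4a+1\\ a+2,a+2,a+2,a+2\end{matrix}\Bigl|1\Bigr)\\&-\frac{4a^3}{(a+1)^4}\,{}_{5}F_4\Bigl(\begin{matrix}1,1,1,2,4a+1\\ a+2,a+2,a+2,a+2\end{matrix}\Bigl|1\Bigr)\\&-\frac{a^4}{(a+1)^4}\,{}_{5}F_4\Bigl(\begin{matrix}1,1,1,1,4a+1\\ a+2,a+2,a+2,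a+2\end{matrix}\Bigl|1\Bigr)\biggr).\end{aligned}$$
   Context: $\Gamma$ is the Euler Gamma function. The generalized hypergeometric function is defined by the series $${}_{p}F_q\Bigl(\begin{matrix}a_1,\ldots,a_p\\ b_1,\ldots,b_q\end{matrix}\Bigl|z\Bigr)=\sum_{n=0}^{\infty}\frac{(a_1)_n\cdots(a_p)_n}{(b_1)_n\cdots(b_q)_n\,n!}\,z^n,$$ where $(x)_n$ is the rising Pochhammer symbol: $(x)_0=1$ and $(x)_n=x(x+1)\cdots(x+n-1)$ for $n\ge 1$. The value at $z=1$ is the sum of the series at $z=1$. *)

theory Defs
  imports "HOL-Analysis.Analysis"
begin

text \<open>
  The library provides the hypergeometric series only as a formal power series; its last
  argument rescales the variable and is 1 here. The function \<open>hypergeo\<close> is the sum of that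
  series, also on the boundary of the disc of convergence. Since \<open>suminf\<close> carries no
  information about a divergent series, convergence is a separate predicate.
\<close>

definition hypergeo :: "real list \<Rightarrow> real list \<Rightarrow> real \<Rightarrow> real" where
  "hypergeo as bs z = eval_fps (fps_hypergeo as bs 1) z"

definition hypergeo_converges :: "real list \<Rightarrow> real list \<Rightarrow> real \<Rightarrow> bool" where
  "hypergeo_converges as bs z \<longleftrightarrow> summable (\<lambda>n. fps_nth (fps_hypergeo as bs 1) n * z ^ n)"

lemma foldl_mult_eq_prod_list:
  fixes c :: "'a::comm_monoid_mult"
  shows "foldl (\<lambda>r x. r * f x) c xs = c * (\<Prod>x\<leftarrow>xs. f x)"
  by (induction xs arbitrary: c) (simp_all add: mult.assoc)

lemma fps_hypergeo_nth_prod_list: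
  fixes as bs :: "real list"
  shows "fps_nth (fps_hypergeo as bs 1) n =
    (\<Prod>a\<leftarrow>as. pochhammer a n) / ((\<Prod>b\<leftarrow>bs. pochhammer b n) * fact n)"
  by (simp add: foldl_mult_eq_prod_list)

lemma hypergeo_eq_suminf:
  "hypergeo as bs z =
    (\<Sum>n. (\<Prod>a\<leftarrow>as. pochhammer a n) / ((\<Prod>b\<leftarrow>bs. pochhammer b n) * fact n) * z ^ n)"
  unfolding hypergeo_def eval_fps_def fps_hypergeo_nth_prod_list ..

lemma hypergeo_converges_iff_summable:
  "hypergeo_converges as bs z \<longleftrightarrow>
    summable (\<lambda>n. (\<Prod>a\<leftarrow>as. pochhammer a n) / ((\<Prod>b\<leftarrow>bs. pochhammer b n) * fact n) * z ^ n)"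
  unfolding hypergeo_converges_def fps_hypergeo_nth_prod_list ..

end

theory Submission
  imports Defs
begin

text \<open>
  For a positive integer \<open>k\<close> put \<open>P n = (n!)^(k-1) (ka+1)_n / (a+1)_n^k\<close>. Then \<open>P 0 = 1\<close>, while Gauss's product
  for \<open>\<Gamma>\<close> gives \<open>P n \<longlonglongrightarrow> \<Gamma>(a+1)^k / \<Gamma>(ka+1)\<close>. With \<open>m = n + 1\<close> the difference \<open>P n - P (n+1)\<close>
  equals \<open>((m+a)^k - m^(k-1) (m+ka)) P n / (m+a)^k\<close>, and expanding the binomial for \<open>k = 2, 3, 4\<close>
  splits this telescoping series into the hypergeometric series of the three identities.
\<close>

section \<open>The telescoping quantity and its limit\<close>

text \<open>Indexing by \<open>j = k - 1\<close> avoids truncated subtraction.\<close>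

definition gamma_ratio :: "nat \<Rightarrow> real \<Rightarrow> nat \<Rightarrow> real" where
  "gamma_ratio j a n =
    fact n ^ j * pochhammer (real (Suc j) * a + 1) n / pochhammer (a + 1) n ^ Suc j"

text \<open>With \<open>pochhammer 1 n = fact n\<close>, this is the n-th term at 1 of the
  hypergeometric series with \<open>Suc j\<close> upper parameters 1, one more
  \<open>real (Suc j) * a + 1\<close>, and \<open>Suc j\<close> lower parameters
  \<open>a + 2\<close>.\<close>

definition gamma_ratio_shift :: "nat \<Rightarrow> real \<Rightarrow> nat \<Rightarrow> real" where
  "gamma_ratio_shift j a n =
    fact n ^ j * pochhammer (real (Suc j) * a + 1) n / pochhammer (a + 2) n ^ Suc j"

lemma gamma_ratio_shift_pos: "a > 0 \<Longrightarrow> gamma_ratio_shift j a n > 0"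
  unfolding gamma_ratio_shift_def
  by (intro divide_pos_pos mult_pos_pos zero_less_power pochhammer_pos add_nonneg_pos
      mult_nonneg_nonneg) auto

text \<open>Solves Gauss's product for the Pochhammer symbol, using
  \<open>pochhammer x (Suc n) = x * pochhammer (x + 1) n\<close>.\<close>

lemma pochhammer_plus_one_Gamma_series:
  fixes x :: real
  assumes "x > 0"
  shows "pochhammer (x + 1) n = fact n * exp (x * ln (real n)) / (x * Gamma_series x n)"
proof -
  have "pochhammer x (Suc n) > 0"
    using assms by (rule pochhammer_pos)
  then show ?thesis
    using assms by (simp add: Gamma_series_def pochhammer_rec field_simps)
qed

lemma Gamma_plus1_pos:
  fixes x :: real
  shows "x > 0 \<Longrightarrow> Gamma (x + 1) = x * Gamma x"
  by (auto intro!: Gamma_plus1 elim: nonpos_Ints_cases)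

lemma gamma_ratio_LIMSEQ:
  fixes a :: real
  assumes "a > 0"
  shows "gamma_ratio j a \<longlonglongrightarrow> Gamma (a + 1) ^ Suc j / Gamma (real (Suc j) * a + 1)"
proof -
  define b where "b = real (Suc j) * a"
  have b: "b > 0"
    using assms by (simp add: b_def)
  have eq: "gamma_ratio j a n = (a * Gamma_series a n) ^ Suc j / (b * Gamma_series b n)" for n
  proof -
    \<comment> \<open>Since \<open>b\<close> is \<open>Suc j\<close> times \<open>a\<close>, the
      powers of n in the numerator and the denominator cancel exactly, as do the factorials. What is
      left is a quotient of \<open>Gamma_series\<close> terms for every n, not only
      asymptotically.\<close>
    have "exp (b * ln (real n)) = exp (a * ln (real n)) ^ Suc j"
      unfolding b_def by (simp only: mult.assoc exp_of_nat_mult)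
    moreover have "fact n ^ j * (fact n * e ^ Suc j / y) / (fact n * e / x) ^ Suc j = x ^ Suc j / y"
      if "e \<noteq> 0" for e x y :: real
      using that by (simp add: power_divide power_mult_distrib)
    ultimately show ?thesis
      unfolding gamma_ratio_def b_def[symmetric]
        pochhammer_plus_one_Gamma_series[OF assms] pochhammer_plus_one_Gamma_series[OF b]
      by (simp only: exp_not_eq_zero not_False_eq_True)
  qed
  have "(\<lambda>n. (a * Gamma_series a n) ^ Suc j / (b * Gamma_series b n))
      \<longlonglongrightarrow> (a * Gamma a) ^ Suc j / (b * Gamma b)"
  proof (intro tendsto_intros Gamma_series_LIMSEQ)
    show "b * Gamma b \<noteq> 0"
      using mult_pos_pos[OF b Gamma_real_pos[OF b]] by (rule less_imp_neq[THEN not_sym])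
  qed
  moreover have "a * Gamma a = Gamma (a + 1)" "b * Gamma b = Gamma (b + 1)"
    using assms b by (simp_all add: Gamma_plus1_pos)
  ultimately show ?thesis
    by (simp add: eq[abs_def] b_def)
qed

text \<open>Splitting off the last or the first factor of \<open>pochhammer (a + 1) (Suc n)\<close>
  gives \<open>p * (m n + a) = (a + 1) * q\<close>. This brings both terms over the common
  denominator \<open>((a + 1) * q) ^ Suc j\<close> and shifts the lower parameter from
  \<open>a + 1\<close> to \<open>a + 2\<close>.\<close>

lemma gamma_ratio_diff:
  fixes a :: real
  assumes "a > 0"
  defines "m n \<equiv> real n + 1"
  shows "gamma_ratio j a n - gamma_ratio j a (Suc n) =
    ((m n + a) ^ Suc j - m n ^ j * (m n + real (Suc j) * a)) *
      gamma_ratio_shift j a n / (a + 1) ^ Suc j"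
proof -
  define p where "p = pochhammer (a + 1) n"
  define q where "q = pochhammer (a + 2) n"
  define c where "c = fact n ^ j * pochhammer (real (Suc j) * a + 1) n"
  have pos: "p > 0" "q > 0" "m n + a > 0"
    using assms by (auto simp: p_def q_def m_def intro!: pochhammer_pos)
  have "pochhammer (a + 1) (Suc n) = p * (m n + a)"
    by (simp add: pochhammer_Suc p_def m_def add_ac)
  moreover have "pochhammer (a + 1) (Suc n) = (a + 1) * q"
    by (simp add: pochhammer_rec q_def add_ac)
  ultimately have pq: "p * (m n + a) = (a + 1) * q"
    by simp
  have "gamma_ratio j a n = c / p ^ Suc j"
    by (simp add: gamma_ratio_def c_def p_def)
  also have "\<dots> = c * (m n + a) ^ Suc j / (p * (m n + a)) ^ Suc j"
    unfolding power_mult_distrib using pos by simp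
  finally have 1: "gamma_ratio j a n = c * (m n + a) ^ Suc j / ((a + 1) * q) ^ Suc j"
    unfolding pq .
  have "fact (Suc n) = m n * fact n"
    by (simp add: m_def)
  moreover have "pochhammer (real (Suc j) * a + 1) (Suc n) =
      pochhammer (real (Suc j) * a + 1) n * (m n + real (Suc j) * a)"
    unfolding pochhammer_Suc m_def by (simp add: add_ac)
  moreover have "pochhammer (a + 1) (Suc n) = (a + 1) * q"
    by (simp add: pochhammer_rec q_def add_ac)
  ultimately have 2: "gamma_ratio j a (Suc n) =
      c * (m n ^ j * (m n + real (Suc j) * a)) / ((a + 1) * q) ^ Suc j"
    unfolding gamma_ratio_def c_def by (simp only: power_mult_distrib mult_ac)
  have 3: "gamma_ratio_shift j a n = c / q ^ Suc j"
    by (simp add: gamma_ratio_shift_def c_def q_def)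
  have "c * x / (r * s) - c * y / (r * s) = (x - y) * (c / s) / r" for x y r s
    by (simp add: diff_divide_distrib algebra_simps)
  then show ?thesis
    unfolding 1 2 3 power_mult_distrib .
qed

text \<open>The differences telescope. In the polynomial factor the two leading terms of the
  binomial expansion cancel, leaving nonnegative coefficients.\<close>

lemma gamma_ratio_sums:
  fixes a :: real
  assumes "a > 0"
  shows "(\<lambda>n. ((real n + 1 + a) ^ Suc j - (real n + 1) ^ j * (real n + 1 + real (Suc j) * a)) *
      gamma_ratio_shift j a n / (a + 1) ^ Suc j)
    sums (1 - Gamma (a + 1) ^ Suc j / Gamma (real (Suc j) * a + 1))"
proof -
  have "gamma_ratio j a 0 = 1"
    by (simp add: gamma_ratio_def)
  then show ?thesis
    using telescope_sums'[OF gamma_ratio_LIMSEQ[OF assms, of j]]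
    by (simp only: gamma_ratio_diff[OF assms])
qed

section \<open>From convergent sums to hypergeometric values\<close>

text \<open>Each summand is dominated by the sum. Convergence of the individual hypergeometric
  series thus follows from that of the telescoping series, without term asymptotics.\<close>

lemma summable_nonneg_addD:
  fixes f g :: "nat \<Rightarrow> real"
  assumes "summable (\<lambda>n. f n + g n)" "\<And>n. f n \<ge> 0" "\<And>n. g n \<ge> 0"
  shows "summable f" "summable g"
  by (rule summable_comparison_test'[OF assms(1), of 0]; use assms(2,3) in simp)+

lemma hypergeo_eqI:
  assumes "f sums s"
    and "(\<lambda>n. (\<Prod>a\<leftarrow>as. pochhammer a n) / ((\<Prod>b\<leftarrow>bs. pochhammer b n) * fact n)) = f"
  shows "hypergeo_converges as bs 1" "hypergeo as bs 1 = s"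
  using assms(1) unfolding assms(2)[symmetric]
  by (simp_all add: hypergeo_converges_iff_summable hypergeo_eq_suminf sums_iff)

lemma pochhammer_one_real: "pochhammer 1 n = (fact n :: real)"
  by (simp add: pochhammer_fact)

text \<open>Replacing an upper parameter 1 by 2 therefore multiplies the n-th term by n + 1, which
  is how powers of m enter the series.\<close>

lemma pochhammer_two_real: "pochhammer 2 n = (real n + 1) * fact n"
  using pochhammer_rec[of "1::real" n] pochhammer_fact[of "Suc n", where ?'a = real]
  by (simp add: add_ac)

section \<open>The cases k = 2, 3, 4\<close>

lemma hypergeo_two:
  assumes "a > 0"
  shows "hypergeo_converges [1, 1, 2 * a + 1] [a + 2, a + 2] 1"
    and "1 - (a / (a + 1)) ^ 2 * hypergeo [1, 1, 2 * a + 1] [a + 2, a + 2] 1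
      = Gamma (a + 1) ^ 2 / Gamma (2 * a + 1)"
proof -
  let ?d = "gamma_ratio_shift 1 a"
  define S where "S = 1 - Gamma (a + 1) ^ 2 / Gamma (2 * a + 1)"
  \<comment> \<open>Here the polynomial factor is (m+a)^2 - m(m+2a) = a^2, so a single series
    remains.\<close>
  have 1: "(\<lambda>n. (a / (a + 1)) ^ 2 * ?d n) sums S"
    using gamma_ratio_sums[OF assms, of 1] unfolding S_def
    by (simp add: algebra_simps power2_eq_square)
  have "summable ?d"
    using sums_summable[OF 1] assms by (simp add: summable_cmult_iff)
  then have d: "?d sums suminf ?d"
    by (rule summable_sums)
  have S: "S = (a / (a + 1)) ^ 2 * suminf ?d"
    using sums_unique2[OF 1 sums_mult[OF d]] .
  have "(\<lambda>n. (\<Prod>x\<leftarrow>[1, 1, 2 * a + 1]. pochhammer x n) /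
      ((\<Prod>x\<leftarrow>[a + 2, a + 2]. pochhammer x n) * fact n)) = ?d"
    by (simp add: gamma_ratio_shift_def pochhammer_one_real fun_eq_iff power2_eq_square)
  note * = hypergeo_eqI[OF d this]
  show "hypergeo_converges [1, 1, 2 * a + 1] [a + 2, a + 2] 1"
    by (rule *)
  show "1 - (a / (a + 1)) ^ 2 * hypergeo [1, 1, 2 * a + 1] [a + 2, a + 2] 1
      = Gamma (a + 1) ^ 2 / Gamma (2 * a + 1)"
    unfolding * using S by (simp add: S_def)
qed

text \<open>The factor is now 3a^2 m + a^3. The term with m produces the series with a parameter 2,
  the constant term the one with only 1s.\<close>

lemma hypergeo_three:
  assumes "a > 0"
  shows "hypergeo_converges [1, 1, 2, 3 * a + 1] [a + 2, a + 2, a + 2] 1"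
    and "hypergeo_converges [1, 1, 1, 3 * a + 1] [a + 2, a + 2, a + 2] 1"
    and "1 - 3 * a ^ 2 / (a + 1) ^ 3 * hypergeo [1, 1, 2, 3 * a + 1] [a + 2, a + 2, a + 2] 1
        - a ^ 3 / (a + 1) ^ 3 * hypergeo [1, 1, 1, 3 * a + 1] [a + 2, a + 2, a + 2] 1
      = Gamma (a + 1) ^ 3 / Gamma (3 * a + 1)"
proof -
  let ?d = "gamma_ratio_shift 2 a" and ?m = "\<lambda>n. real n + 1"
  let ?A = "3 * a ^ 2 / (a + 1) ^ 3" and ?B = "a ^ 3 / (a + 1) ^ 3"
  define S where "S = 1 - Gamma (a + 1) ^ 3 / Gamma (3 * a + 1)"
  have 1: "(\<lambda>n. ?A * (?m n * ?d n) + ?B * ?d n) sums S"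
  proof -
    have "((?m n + a) ^ 3 - ?m n ^ 2 * (?m n + 3 * a)) * ?d n / (a + 1) ^ 3 =
        ?A * (?m n * ?d n) + ?B * ?d n" for n
    proof -
      have "(?m n + a) ^ 3 - ?m n ^ 2 * (?m n + 3 * a) = 3 * a ^ 2 * ?m n + a ^ 3"
        by algebra
      then show ?thesis
        by (simp only: add_divide_distrib distrib_right mult.assoc times_divide_eq_left)
    qed
    then show ?thesis
      using gamma_ratio_sums[OF assms, of 2] unfolding S_def by (simp add: numeral_3_eq_3)
  qed
  have pos: "?A > 0" "?B > 0" "?d n > 0" for n
    using assms by (auto intro!: divide_pos_pos gamma_ratio_shift_pos)
  \<comment> \<open>The two series must be known to converge separately before the sum may be split.
    Positivity of all terms provides this.\<close>
  have "summable (\<lambda>n. ?A * (?m n * ?d n))" "summable (\<lambda>n. ?B * ?d n)"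
    by (rule summable_nonneg_addD[OF sums_summable[OF 1]];
        intro mult_nonneg_nonneg less_imp_le[OF pos(1)] less_imp_le[OF pos(2)]
          less_imp_le[OF pos(3)]; simp)+
  then have "summable (\<lambda>n. ?m n * ?d n)" "summable ?d"
    using pos(1,2) by (simp_all only: summable_cmult_iff) auto
  then have d: "(\<lambda>n. ?m n * ?d n) sums (\<Sum>n. ?m n * ?d n)" "?d sums suminf ?d"
    by (simp_all only: summable_sums)
  have S: "S = ?A * (\<Sum>n. ?m n * ?d n) + ?B * suminf ?d"
    using sums_unique2[OF 1 sums_add[OF sums_mult[OF d(1)] sums_mult[OF d(2)]]] .
  have e: "(\<lambda>n. (\<Prod>x\<leftarrow>[1, 1, 2, 3 * a + 1]. pochhammer x n) /
      ((\<Prod>x\<leftarrow>[a + 2, a + 2, a + 2]. pochhammer x n) * fact n)) = (\<lambda>n. ?m n * ?d n)"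
    "(\<lambda>n. (\<Prod>x\<leftarrow>[1, 1, 1, 3 * a + 1]. pochhammer x n) /
      ((\<Prod>x\<leftarrow>[a + 2, a + 2, a + 2]. pochhammer x n) * fact n)) = ?d"
    by (simp_all add: gamma_ratio_shift_def pochhammer_one_real pochhammer_two_real fun_eq_iff
        eval_nat_numeral)
  note h = hypergeo_eqI[OF d(1) e(1)] hypergeo_eqI[OF d(2) e(2)]
  show "hypergeo_converges [1, 1, 2, 3 * a + 1] [a + 2, a + 2, a + 2] 1"
    "hypergeo_converges [1, 1, 1, 3 * a + 1] [a + 2, a + 2, a + 2] 1"
    by (rule h)+
  show "1 - ?A * hypergeo [1, 1, 2, 3 * a + 1] [a + 2, a + 2, a + 2] 1
        - ?B * hypergeo [1, 1, 1, 3 * a + 1] [a + 2, a + 2, a + 2] 1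
      = Gamma (a + 1) ^ 3 / Gamma (3 * a + 1)"
    unfolding h using S by (simp add: S_def)
qed

text \<open>The factor is 6a^2 m^2 + 4a^3 m + a^4, and the exponent of m counts the parameters
  2.\<close>

lemma hypergeo_four:
  assumes "a > 0"
  shows "hypergeo_converges [1, 1, 2, 2, 4 * a + 1] [a + 2, a + 2, a + 2, a + 2] 1"
    and "hypergeo_converges [1, 1, 1, 2, 4 * a + 1] [a + 2, a + 2, a + 2, a + 2] 1"
    and "hypergeo_converges [1, 1, 1, 1, 4 * a + 1] [a + 2, a + 2, a + 2, a + 2] 1"
    and "1 - 6 * a ^ 2 / (a + 1) ^ 4
            * hypergeo [1, 1, 2, 2, 4 * a + 1] [a + 2, a + 2, a + 2, a + 2] 1
        - 4 * a ^ 3 / (a + 1) ^ 4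
            * hypergeo [1, 1, 1, 2, 4 * a + 1] [a + 2, a + 2, a + 2, a + 2] 1
        - a ^ 4 / (a + 1) ^ 4
            * hypergeo [1, 1, 1, 1, 4 * a + 1] [a + 2, a + 2, a + 2, a + 2] 1
      = Gamma (a + 1) ^ 4 / Gamma (4 * a + 1)"
proof -
  let ?d = "gamma_ratio_shift 3 a" and ?m = "\<lambda>n. real n + 1"
  let ?A = "6 * a ^ 2 / (a + 1) ^ 4" and ?B = "4 * a ^ 3 / (a + 1) ^ 4"
    and ?C = "a ^ 4 / (a + 1) ^ 4"
  define S where "S = 1 - Gamma (a + 1) ^ 4 / Gamma (4 * a + 1)"
  have 1: "(\<lambda>n. ?A * (?m n ^ 2 * ?d n) + ?B * (?m n * ?d n) + ?C * ?d n) sums S"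
  proof -
    have "((?m n + a) ^ 4 - ?m n ^ 3 * (?m n + 4 * a)) * ?d n / (a + 1) ^ 4 =
        ?A * (?m n ^ 2 * ?d n) + ?B * (?m n * ?d n) + ?C * ?d n" for n
    proof -
      have "(?m n + a) ^ 4 - ?m n ^ 3 * (?m n + 4 * a) =
          6 * a ^ 2 * ?m n ^ 2 + 4 * a ^ 3 * ?m n + a ^ 4"
        by algebra
      then show ?thesis
        by (simp only: add_divide_distrib distrib_right mult.assoc times_divide_eq_left)
    qed
    moreover have "Suc 3 = 4"
      by simp
    ultimately show ?thesis
      using gamma_ratio_sums[OF assms, of 3] unfolding S_def by (simp only: of_nat_numeral)
  qed
  have pos: "?A > 0" "?B > 0" "?C > 0" "?d n > 0" for n
    using assms by (auto intro!: divide_pos_pos gamma_ratio_shift_pos)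
  have nonneg: "?A * (?m n ^ 2 * ?d n) \<ge> 0" "?B * (?m n * ?d n) \<ge> 0" "?C * ?d n \<ge> 0" for n
    by (intro mult_nonneg_nonneg less_imp_le[OF pos(1)] less_imp_le[OF pos(2)]
        less_imp_le[OF pos(3)] less_imp_le[OF pos(4)]; simp)+
  \<comment> \<open>The three-term sum is split in two stages: \<open>AB(2)\<close> isolates the
    last series, and \<open>AB(1)\<close> keeps the first two together for a second
    application.\<close>
  note AB = summable_nonneg_addD[OF sums_summable[OF 1] add_nonneg_nonneg[OF nonneg(1,2)] nonneg(3)]
  have "summable (\<lambda>n. ?A * (?m n ^ 2 * ?d n))" "summable (\<lambda>n. ?B * (?m n * ?d n))"
    "summable (\<lambda>n. ?C * ?d n)"
    by (fact summable_nonneg_addD[OF AB(1) nonneg(1,2)] AB(2))+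
  then have "summable (\<lambda>n. ?m n ^ 2 * ?d n)" "summable (\<lambda>n. ?m n * ?d n)" "summable ?d"
    using pos(1-3) by (simp_all only: summable_cmult_iff) auto
  then have d: "(\<lambda>n. ?m n ^ 2 * ?d n) sums (\<Sum>n. ?m n ^ 2 * ?d n)"
    "(\<lambda>n. ?m n * ?d n) sums (\<Sum>n. ?m n * ?d n)" "?d sums suminf ?d"
    by (simp_all only: summable_sums)
  have S: "S = ?A * (\<Sum>n. ?m n ^ 2 * ?d n) + ?B * (\<Sum>n. ?m n * ?d n) + ?C * suminf ?d"
    using sums_unique2[OF 1 sums_add[OF sums_add[OF sums_mult[OF d(1)] sums_mult[OF d(2)]]
          sums_mult[OF d(3)]]] .
  have e: "(\<lambda>n. (\<Prod>x\<leftarrow>[1, 1, 2, 2, 4 * a + 1]. pochhammer x n) /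
      ((\<Prod>x\<leftarrow>[a + 2, a + 2, a + 2, a + 2]. pochhammer x n) * fact n)) = (\<lambda>n. ?m n ^ 2 * ?d n)"
    "(\<lambda>n. (\<Prod>x\<leftarrow>[1, 1, 1, 2, 4 * a + 1]. pochhammer x n) /
      ((\<Prod>x\<leftarrow>[a + 2, a + 2, a + 2, a + 2]. pochhammer x n) * fact n)) = (\<lambda>n. ?m n * ?d n)"
    "(\<lambda>n. (\<Prod>x\<leftarrow>[1, 1, 1, 1, 4 * a + 1]. pochhammer x n) /
      ((\<Prod>x\<leftarrow>[a + 2, a + 2, a + 2, a + 2]. pochhammer x n) * fact n)) = ?d"
    by (simp_all add: gamma_ratio_shift_def pochhammer_one_real pochhammer_two_real fun_eq_iff
        eval_nat_numeral)
  note h = hypergeo_eqI[OF d(1) e(1)] hypergeo_eqI[OF d(2) e(2)]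
    hypergeo_eqI[OF d(3) e(3)]
  show "hypergeo_converges [1, 1, 2, 2, 4 * a + 1] [a + 2, a + 2, a + 2, a + 2] 1"
    "hypergeo_converges [1, 1, 1, 2, 4 * a + 1] [a + 2, a + 2, a + 2, a + 2] 1"
    "hypergeo_converges [1, 1, 1, 1, 4 * a + 1] [a + 2, a + 2, a + 2, a + 2] 1"
    by (rule h)+
  show "1 - ?A * hypergeo [1, 1, 2, 2, 4 * a + 1] [a + 2, a + 2, a + 2, a + 2] 1
        - ?B * hypergeo [1, 1, 1, 2, 4 * a + 1] [a + 2, a + 2, a + 2, a + 2] 1
        - ?C * hypergeo [1, 1, 1, 1, 4 * a + 1] [a + 2, a + 2, a + 2, a + 2] 1
      = Gamma (a + 1) ^ 4 / Gamma (4 * a + 1)"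
    unfolding h using S by (simp add: S_def)
qed

theorem theorem2p1:
  fixes a :: real
  assumes "a > 1 / 2"
  shows
    "(hypergeo_converges [1, 1, 2 * a + 1] [a + 2, a + 2] 1 \<and>
      1 / ((2 * a - 1) * Gamma (2 * a)) =
      2 * a / ((2 * a - 1) * Gamma (a + 1) ^ 2) *
        (1 - (a / (a + 1)) ^ 2 * hypergeo [1, 1, 2 * a + 1] [a + 2, a + 2] 1))
   \<and> (hypergeo_converges [1, 1, 2, 3 * a + 1] [a + 2, a + 2, a + 2] 1 \<and>
      hypergeo_converges [1, 1, 1, 3 * a + 1] [a + 2, a + 2, a + 2] 1 \<and>
      (a + 1) / (a * (2 * a - 1) * Gamma (3 * a)) =
      3 * (a + 1) / ((2 * a - 1) * Gamma (a + 1) ^ 3) *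
        (1 - 3 * a ^ 2 / (a + 1) ^ 3 * hypergeo [1, 1, 2, 3 * a + 1] [a + 2, a + 2, a + 2] 1
           - a ^ 3 / (a + 1) ^ 3 * hypergeo [1, 1, 1, 3 * a + 1] [a + 2, a + 2, a + 2] 1))
   \<and> (hypergeo_converges [1, 1, 2, 2, 4 * a + 1] [a + 2, a + 2, a + 2, a + 2] 1 \<and>
      hypergeo_converges [1, 1, 1, 2, 4 * a + 1] [a + 2, a + 2, a + 2, a + 2] 1 \<and>
      hypergeo_converges [1, 1, 1, 1, 4 * a + 1] [a + 2, a + 2, a + 2, a + 2] 1 \<and>
      6 * (2 * a ^ 2 + 2 * a - 1) / ((4 * a - 1) * (2 * a - 1) ^ 2 * Gamma (4 * a)) =
      24 * a * (2 * a ^ 2 + 2 * a - 1) / ((4 * a - 1) * (2 * a - 1) ^ 2 * Gamma (a + 1) ^ 4) *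
        (1 - 6 * a ^ 2 / (a + 1) ^ 4
               * hypergeo [1, 1, 2, 2, 4 * a + 1] [a + 2, a + 2, a + 2, a + 2] 1
           - 4 * a ^ 3 / (a + 1) ^ 4
               * hypergeo [1, 1, 1, 2, 4 * a + 1] [a + 2, a + 2, a + 2, a + 2] 1
           - a ^ 4 / (a + 1) ^ 4
               * hypergeo [1, 1, 1, 1, 4 * a + 1] [a + 2, a + 2, a + 2, a + 2] 1))"
proof -
  have a: "a > 0"
    using assms by simp
  have G: "Gamma (c * a + 1) = c * a * Gamma (c * a)" if "c > 0" for c
    using mult_pos_pos[OF that a] by (rule Gamma_plus1_pos)
  have g: "Gamma (a + 1) ^ k \<noteq> 0" for k
    using a by (intro less_imp_neq[THEN not_sym] zero_less_power Gamma_real_pos) simp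
  \<comment> \<open>Here \<open>x\<close> is the power of \<open>Gamma (a + 1)\<close>, and
    \<open>c\<close> is the factor by which numerator and denominator of the left side are expanded.
    It is \<open>2 * a\<close> and \<open>4 * a\<close> in (i) and (iii), but only 3 in (ii), where
    the left denominator already contains \<open>a\<close>.\<close>
  have cancel: "u / v = t / (w * x) * (x / y)"
    if "x \<noteq> 0" "c \<noteq> 0" "t = c * u" "w * y = c * v" for c t u v w x y :: real
  proof -
    have "u / v = t / (w * y)"
      unfolding that(3,4) using that(2) by simp
    then show ?thesis
      using that(1) by simp
  qed
  show ?thesis
    \<comment> \<open>Each bracket becomes \<open>Gamma (a + 1) ^ k / Gamma (k * a + 1)\<close>, so
      only the functional equation \<open>G\<close> and cancellation remain.\<close>
    unfolding hypergeo_two(2)[OF a] hypergeo_three(3)[OF a] hypergeo_four(4)[OF a]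
  proof (intro conjI hypergeo_two(1)[OF a] hypergeo_three(1,2)[OF a] hypergeo_four(1,2,3)[OF a])
    show "1 / ((2 * a - 1) * Gamma (2 * a)) =
        2 * a / ((2 * a - 1) * Gamma (a + 1) ^ 2) * (Gamma (a + 1) ^ 2 / Gamma (2 * a + 1))"
      using a by (intro cancel[OF g, of "2 * a"]) (simp_all add: G)
    show "(a + 1) / (a * (2 * a - 1) * Gamma (3 * a)) =
        3 * (a + 1) / ((2 * a - 1) * Gamma (a + 1) ^ 3) *
        (Gamma (a + 1) ^ 3 / Gamma (3 * a + 1))"
      using a by (intro cancel[OF g, of 3]) (simp_all add: G)
    show "6 * (2 * a ^ 2 + 2 * a - 1) / ((4 * a - 1) * (2 * a - 1) ^ 2 * Gamma (4 * a)) =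
        24 * a * (2 * a ^ 2 + 2 * a - 1) / ((4 * a - 1) * (2 * a - 1) ^ 2 * Gamma (a + 1) ^ 4) *
        (Gamma (a + 1) ^ 4 / Gamma (4 * a + 1))"
      using a by (intro cancel[OF g, of "4 * a"]) (simp_all add: G)
  qed
qed

end
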